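(* Let $G=(V,A)$ be a directed graph with $n=|V|$, $m=|A|$, arc costs $c:A\to\mathbb{Z}_+$, and $s\ne t\in V$. Let $\lambda\in\mathbb{Z}^{n-1}$ with $\lambda_i>0$ for some $i\in\{1,\dots,n-1\}$ and $\lambda_j=0$ for all $j\in\{1,\dots,n-1\}$, $j\ne i$, and let $B=(1+\varepsilon)\cdot f^*_\lambda(s,t)$ for some $\varepsilon>0$. Then the cardinality of the minimal complete set $P^{NSP}_{min}(s,t)$ of the universal near shortest simple paths problem UNSSPP$(G,\lambda)$ is smaller than or equal to the number of arcs in $G$, i.e. $|P^{NSP}_{min}(s,t)|\le |A|=m$.
   Context: $\mathbb{Z}_+$ denotes the nonnegative integers. $\mathcal{P}_{st}$ is the set of all simple directed $s$-$t$-paths in $G$ (assumed nonempty); $l(P)\le n-1$ is the number of arcs of $P$. For a path $P$, $c_{(i)}(P)$ is the $i$-th largest arc cost on $P$ for $1\le i\le l(P)$, and $c_{(i)}(P)=0$ for $l(P)<i\le n-1$. $f_\lambda(P)=\sum_{i=1}^{n-1}\lambda_ic_{(i)}(P)$ and $f^*_\lambda(s,t)=\min_{P\in\mathcal{P}_{st}}f_\lambda(P)$. UNSSPP$(G,\lambda)$ asks to enumerate $P^{NSP}(s,t)=\{P\in\mathcal{P}_{st}: f_\lambda(P)\le B\}$. Two paths $P_1,P_2\in\mathcal{P}_{st}$ are equivalent iff $f_\lambda(P_1)=f_\lambda(P_2)$. A minimal complete set $P^{NSP}_{min}(s,t)\subseteq P^{NSP}(s,t)$ is a set such that every $P\in P^{NSP}(s,t)\setminus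 P^{NSP}_{min}(s,t)$ is equivalent to exactly one $P'\in P^{NSP}_{min}(s,t)$; being minimal, it contains exactly one representative of each equivalence class of $P^{NSP}(s,t)$. *)

theory Defs
  imports Complex_Main "Graph_Theory.Graph_Theory"
begin

text \<open>A path is its list of arcs; \<open>apath\<close> forbids repeated vertices.\<close>

definition st_paths :: "('a, 'b) pre_digraph \<Rightarrow> 'a \<Rightarrow> 'a \<Rightarrow> 'b list set" where
  "st_paths G s t = {P. pre_digraph.apath G s P t}"

text \<open>The \<open>i\<close>-th largest arc cost on \<open>P\<close>, for \<open>i \<ge> 1\<close> (counted with multiplicity), padded
  with zeros beyond the length of \<open>P\<close>.\<close>

definition ith_largest_cost :: "('b \<Rightarrow> nat) \<Rightarrow> 'b list \<Rightarrow> nat \<Rightarrow> nat" where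
  "ith_largest_cost c P i = (if i \<le> length P then rev (sort (map c P)) ! (i - 1) else 0)"

text \<open>A vector \<open>\<lambda>\<close> in \<open>\<int>\<^sup>n\<^sup>-\<^sup>1\<close> is a function of which only the values at \<open>1, \<dots>, n - 1\<close> are used.\<close>

definition universal_cost ::
  "('a, 'b) pre_digraph \<Rightarrow> ('b \<Rightarrow> nat) \<Rightarrow> (nat \<Rightarrow> int) \<Rightarrow> 'b list \<Rightarrow> int" where
  "universal_cost G c lam P =
     (\<Sum>i = 1..card (verts G) - 1. lam i * int (ith_largest_cost c P i))"

definition opt_universal_cost ::
  "('a, 'b) pre_digraph \<Rightarrow> ('b \<Rightarrow> nat) \<Rightarrow> (nat \<Rightarrow> int) \<Rightarrow> 'a \<Rightarrow> 'a \<Rightarrow> int" where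
  "opt_universal_cost G c lam s t = Min (universal_cost G c lam ` st_paths G s t)"

definition near_shortest_paths ::
  "('a, 'b) pre_digraph \<Rightarrow> ('b \<Rightarrow> nat) \<Rightarrow> (nat \<Rightarrow> int) \<Rightarrow> 'a \<Rightarrow> 'a \<Rightarrow> real \<Rightarrow> 'b list set" where
  "near_shortest_paths G c lam s t B =
     {P \<in> st_paths G s t. real_of_int (universal_cost G c lam P) \<le> B}"

definition complete_set :: "('p \<Rightarrow> 'v) \<Rightarrow> 'p set \<Rightarrow> 'p set \<Rightarrow> bool" where
  "complete_set f N M \<longleftrightarrow> M \<subseteq> N \<and> (\<forall>P \<in> N - M. \<exists>!P'. P' \<in> M \<and> f P = f P')"

text \<open>Completeness alone does not exclude equivalent members of \<open>M\<close> (\<open>N\<close> itself is complete);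
  it is minimality with respect to inclusion that leaves one representative of each class,
  see \<open>minimal_complete_set_iff\<close>.\<close>

definition minimal_complete_set :: "('p \<Rightarrow> 'v) \<Rightarrow> 'p set \<Rightarrow> 'p set \<Rightarrow> bool" where
  "minimal_complete_set f N M \<longleftrightarrow>
     complete_set f N M \<and> (\<forall>M'. complete_set f N M' \<and> M' \<subseteq> M \<longrightarrow> M' = M)"

lemma minimal_complete_set_iff:
  "minimal_complete_set f N M \<longleftrightarrow> M \<subseteq> N \<and> (\<forall>P \<in> N. \<exists>!P'. P' \<in> M \<and> f P = f P')"
proof
  assume min: "minimal_complete_set f N M"
  then have sub: "M \<subseteq> N" and compl: "\<forall>P \<in> N - M. \<exists>!P'. P' \<in> M \<and> f P = f P'"
    by (auto simp: minimal_complete_set_def complete_set_def)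
  have "Q = P" if P: "P \<in> M" and Q: "Q \<in> M" and eq: "f P = f Q" for P Q
  proof (rule ccontr)
    assume ne: "Q \<noteq> P"
    have no_outside: "f R \<noteq> f P" if "R \<in> N - M" for R
      using compl that P Q eq ne by metis
    define M' where "M' = M - {R \<in> M. f R = f P \<and> R \<noteq> P}"
    have "complete_set f N M'"
      unfolding complete_set_def
    proof (intro conjI ballI)
      show "M' \<subseteq> N" using sub by (auto simp: M'_def)
    next
      fix R assume R: "R \<in> N - M'"
      show "\<exists>!P'. P' \<in> M' \<and> f R = f P'"
      proof (cases "R \<in> M")
        case True
        then have "f R = f P" using R by (auto simp: M'_def)
        then show ?thesis using P by (auto simp: M'_def intro!: ex1I[of _ P])
      next
        case False
        then have "R \<in> N - M" using R by auto
        then obtain P' where "P' \<in> M" "f R = f P'" "\<And>X. X \<in> M \<Longrightarrow> f R = f X \<Longrightarrow> X = P'"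
          using compl by metis
        then show ?thesis
          using no_outside[OF \<open>R \<in> N - M\<close>] by (intro ex1I[of _ P']) (auto simp: M'_def)
      qed
    qed
    then have "M' = M"
      using min by (auto simp: minimal_complete_set_def M'_def)
    then show False using Q eq ne by (auto simp: M'_def)
  qed
  then have "\<exists>!P'. P' \<in> M \<and> f P = f P'" if "P \<in> N" for P
    using compl that by (metis DiffI)
  with sub show "M \<subseteq> N \<and> (\<forall>P \<in> N. \<exists>!P'. P' \<in> M \<and> f P = f P')" by blast
next
  assume r: "M \<subseteq> N \<and> (\<forall>P \<in> N. \<exists>!P'. P' \<in> M \<and> f P = f P')"
  have "M' = M" if compl: "complete_set f N M'" and sub: "M' \<subseteq> M" for M'
  proof (rule ccontr)
    assume "M' \<noteq> M"
    then obtain P where P: "P \<in> M" "P \<notin> M'" using sub by auto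
    then have "P \<in> N - M'" using r by auto
    then obtain P' where P': "P' \<in> M'" "f P = f P'"
      using compl unfolding complete_set_def by blast
    have "\<exists>!X. X \<in> M \<and> f P = f X" using r P by blast
    then have "P' = P" using P P' sub by blast
    then show False using P P' by simp
  qed
  then show "minimal_complete_set f N M"
    using r by (auto simp: minimal_complete_set_def complete_set_def)
qed

lemma minimal_complete_set_exists: "\<exists>M. minimal_complete_set f N M"
proof -
  define rep where "rep v = (SOME P. P \<in> N \<and> f P = v)" for v
  have rep: "rep (f P) \<in> N \<and> f (rep (f P)) = f P" if "P \<in> N" for P
    unfolding rep_def by (rule someI[of _ P]) (use that in simp)
  have "minimal_complete_set f N (rep ` f ` N)"
    unfolding minimal_complete_set_iff
  proof (intro conjI ballI)
    fix P assume "P \<in> N"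
    then show "\<exists>!P'. P' \<in> rep ` f ` N \<and> f P = f P'"
      using rep by (intro ex1I[of _ "rep (f P)"]) auto
  qed (use rep in auto)
  then show ?thesis by blast
qed

end

theory Submission
  imports Defs
begin

text \<open>
  Equivalent paths have equal cost, so a minimal complete set injects into the set of costs that occur.
  A path with at least \<open>i\<close> arcs has cost \<open>\<lambda>\<^sub>i c(a)\<close> for some arc \<open>a\<close>; a shorter one has cost \<open>0\<close>, a
  value that need not come from an arc. However, if some path has cost \<open>0\<close>, then the optimum and
  hence \<open>B\<close> are \<open>0\<close>, so that there is only one class.
\<close>

lemma universal_cost_single:
  assumes "i \<in> {1..card (verts G) - 1}"
    and "\<forall>j \<in> {1..card (verts G) - 1}. j \<noteq> i \<longrightarrow> lam j = 0"
  shows "universal_cost G c lam P = lam i * int (ith_largest_cost c P i)"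
proof -
  have "universal_cost G c lam P =
      (\<Sum>j \<in> {1..card (verts G) - 1}. if j = i then lam i * int (ith_largest_cost c P i) else 0)"
    unfolding universal_cost_def using assms(2) by (intro sum.cong) auto
  then show ?thesis using assms(1) by simp
qed

lemma ith_largest_cost_in_image:
  assumes "1 \<le> i" and "i \<le> length P"
  shows "ith_largest_cost c P i \<in> c ` set P"
proof -
  have "rev (sort (map c P)) ! (i - 1) \<in> set (rev (sort (map c P)))"
    using assms by (intro nth_mem) simp
  then show ?thesis using assms by (simp add: ith_largest_cost_def)
qed

lemma set_subset_arcs_if_st_path:
  "P \<in> st_paths G s t \<Longrightarrow> set P \<subseteq> arcs G"
  by (auto simp: st_paths_def pre_digraph.apath_def pre_digraph.awalk_def)

lemma st_path_nonempty:
  "P \<in> st_paths G s t \<Longrightarrow> s \<noteq> t \<Longrightarrow> P \<noteq> []"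
  by (auto simp: st_paths_def pre_digraph.apath_def pre_digraph.awalk_def pre_digraph.cas.simps)

text \<open>A member of \<open>M\<close> lies in \<open>N\<close> and represents itself, so
  uniqueness of representatives excludes a second member with the same value.\<close>

lemma inj_on_minimal_complete_set:
  "minimal_complete_set f N M \<Longrightarrow> inj_on f M"
  unfolding minimal_complete_set_iff inj_on_def by (metis subsetD)

theorem theorem4p4:
  fixes G :: "('a, 'b) pre_digraph"
    and c :: "'b \<Rightarrow> nat"
    and s t :: 'a
    and lam :: "nat \<Rightarrow> int"
    and i :: nat
    and \<epsilon> B :: real
    and M :: "'b list set"
  assumes "fin_digraph G"
    and "s \<in> verts G" and "t \<in> verts G" and "s \<noteq> t"
    and "st_paths G s t \<noteq> {}"
    and "i \<in> {1..card (verts G) - 1}" and "lam i > 0"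
    and "\<forall>j \<in> {1..card (verts G) - 1}. j \<noteq> i \<longrightarrow> lam j = 0"
    and "\<epsilon> > 0"
    and "B = (1 + \<epsilon>) * real_of_int (opt_universal_cost G c lam s t)"
    and "minimal_complete_set (universal_cost G c lam) (near_shortest_paths G c lam s t B) M"
  shows "finite M \<and> card M \<le> card (arcs G)"
proof -
  let ?f = "universal_cost G c lam"
  let ?S = "st_paths G s t"
  interpret fin_digraph G by fact
  have f_eq: "?f P = lam i * int (ith_largest_cost c P i)" for P
    using universal_cost_single assms(6,8) by blast
  have f_nonneg: "0 \<le> ?f P" for P using f_eq \<open>lam i > 0\<close> by simp
  have fin: "finite ?S"
    unfolding st_paths_def by (rule apaths_finite)
  have M: "M \<subseteq> near_shortest_paths G c lam s t B"
    using assms(11) by (simp add: minimal_complete_set_iff)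
  then have MS: "M \<subseteq> ?S" by (auto simp: near_shortest_paths_def)
  have inj: "inj_on ?f M" using assms(11) by (rule inj_on_minimal_complete_set)
  have "card (?f ` M) \<le> card (arcs G)"
  proof (cases "\<exists>P \<in> ?S. ?f P = 0")
    case True
    then obtain P where P: "P \<in> ?S" "?f P = 0" by blast
    \<comment> \<open>Costs are nonnegative because \<open>lam i > 0\<close>, so a path of cost 0
      attains the minimum.\<close>
    have "opt_universal_cost G c lam s t = 0"
      unfolding opt_universal_cost_def
      using P f_nonneg fin by (intro Min_eqI) (auto intro: rev_image_eqI)
    then have "B = 0" using assms(10) by simp
    then have "?f ` M \<subseteq> {0}"
      using M f_nonneg by (force simp: near_shortest_paths_def intro: antisym)
    then have "card (?f ` M) \<le> 1" using card_mono[of "{0}" "?f ` M"] by simp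
    \<comment> \<open>The single class must still be matched by an arc: as
      \<open>s \<noteq> t\<close>, the path \<open>P\<close> contains one.\<close>
    also have "arcs G \<noteq> {}"
      using set_subset_arcs_if_st_path[OF P(1)] st_path_nonempty[OF P(1) \<open>s \<noteq> t\<close>] by auto
    then have "1 \<le> card (arcs G)" by (simp add: Suc_le_eq card_gt_0_iff)
    finally show ?thesis .
  next
    case False
    have "?f P \<in> (\<lambda>a. lam i * int (c a)) ` arcs G" if "P \<in> M" for P
    proof -
      have P: "P \<in> ?S" using that MS by blast
      then have "ith_largest_cost c P i \<noteq> 0"
        using False f_eq[of P] by auto
      \<comment> \<open>A nonzero value cannot be the padding, so position \<open>i\<close> lies on
        the path.\<close>
      then have "i \<le> length P"
        by (auto simp: ith_largest_cost_def split: if_splits)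
      then have "ith_largest_cost c P i \<in> c ` set P"
        using assms(6) by (intro ith_largest_cost_in_image) auto
      then show ?thesis using f_eq set_subset_arcs_if_st_path[OF P] by auto
    qed
    \<comment> \<open>Inclusion in an image of the finite set \<open>arcs G\<close> suffices; arcs
      of equal cost only shrink that image.\<close>
    then show ?thesis by (intro surj_card_le) auto
  qed
  \<comment> \<open>Finiteness of \<open>M\<close> comes from that of the set of simple paths;
    injectivity carries the bound from costs back to \<open>M\<close>.\<close>
  then show ?thesis using finite_subset[OF MS fin] card_image[OF inj] by simp
qed

end
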